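(* For every integer $k>3$ we have $$\max\mathcal{F}_k\le 2^{k^{10^{10}\log\log k}}.$$
   Context: For an integer $k\ge 1$ let $U_0(k)=0$, $U_1(k)=1$, $U_{n+2}(k)=(4k+2)U_{n+1}(k)-U_n(k)$ for $n\ge 0$. For fixed $k$ these integers are pairwise distinct. The discriminator $\mathcal{D}_k(n)$ ($n\ge 1$) is the smallest integer $m\ge 1$ such that $U_0(k),\ldots,U_{n-1}(k)$ are pairwise incongruent modulo $m$. Put $\mathcal{D}_k=\{\mathcal{D}_k(n):n\ge 1\}$. The sets $\mathcal{A}_k,\mathcal{B}_k$ of positive integers ($p$ denotes primes): $\mathcal{A}_k=\{m \text{ odd}: p\mid m\Rightarrow p\mid k\}$ if $k\not\equiv 6\pmod 9$, and $\mathcal{A}_k=\{m\text{ odd},\ 9\nmid m: p\mid m\Rightarrow p\mid k\}$ if $k\equiv 6\pmod 9$; $\mathcal{B}_k=\{m\text{ even}: p\mid m\Rightarrow p\mid k(k+1)\}$ if $k\not\equiv 6\pmod 9$ and $k\not\equiv 2\pmod 9$, and $\mathcal{B}_k=\{m\text{ even},\ 9\nmid m: p\mid m\Rightarrow p\mid k(k+1)\}$ if $k\equiv 6\pmod 9$ or $k\equiv 2\pmod 9$. The exceptional set is $\mathcal{F}_k=\mathcal{D}_k\setminus(\mathcal{A}_k\cup\mathcal{B}_k)$. The bound on $\max\mathcal{F}_k$ means that every element of $\mathcal{F}_k$ is at most the right-hand side (vacuous if $\mathcal{F}_k=\emptyset$). Here $\log$ is the natural logarithm. *)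

theory Defs
  imports Complex_Main "HOL-Number_Theory.Cong" "HOL-Computational_Algebra.Primes"
begin

fun U :: "nat \<Rightarrow> nat \<Rightarrow> int" where
  "U k 0 = 0"
| "U k (Suc 0) = 1"
| "U k (Suc (Suc n)) = (4 * int k + 2) * U k (Suc n) - U k n"

definition pairwise_incong :: "nat \<Rightarrow> nat \<Rightarrow> nat \<Rightarrow> bool" where
  "pairwise_incong k n m \<longleftrightarrow>
     (\<forall>i<n. \<forall>j<n. i \<noteq> j \<longrightarrow> \<not> [U k i = U k j] (mod int m))"

text \<open>For \<open>k \<ge> 1\<close> the terms \<open>U k i\<close> are pairwise distinct, so a suitable modulus exists
  and \<open>LEAST\<close> below is meaningful.  The condition \<open>m \<ge> 1\<close> is essential: congruence modulo
  \<open>0\<close> is equality.\<close>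

definition discriminator :: "nat \<Rightarrow> nat \<Rightarrow> nat" where
  "discriminator k n = (LEAST m. m \<ge> 1 \<and> pairwise_incong k n m)"

definition D_set :: "nat \<Rightarrow> nat set" where
  "D_set k = {discriminator k n | n. n \<ge> 1}"

definition A_set :: "nat \<Rightarrow> nat set" where
  "A_set k =
     (if k mod 9 \<noteq> 6
      then {m. m > 0 \<and> odd m \<and> (\<forall>p. prime p \<and> p dvd m \<longrightarrow> p dvd k)}
      else {m. m > 0 \<and> odd m \<and> \<not> 9 dvd m \<and> (\<forall>p. prime p \<and> p dvd m \<longrightarrow> p dvd k)})"

definition B_set :: "nat \<Rightarrow> nat set" where
  "B_set k =
     (if k mod 9 \<noteq> 6 \<and> k mod 9 \<noteq> 2
      then {m. m > 0 \<and> even m \<and> (\<forall>p. prime p \<and> p dvd m \<longrightarrow> p dvd k * (k + 1))}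
      else {m. m > 0 \<and> even m \<and> \<not> 9 dvd m \<and> (\<forall>p. prime p \<and> p dvd m \<longrightarrow> p dvd k * (k + 1))})"

definition F_set :: "nat \<Rightarrow> nat set" where
  "F_set k = D_set k - (A_set k \<union> B_set k)"

end

theory Submission
  imports Defs "HOL-Number_Theory.Residues"
begin

text \<open>The argument is elementary and gives the far smaller bound \<open>2 * q ^ q\<close>, where \<open>q \<le> k + 1\<close> is an
  odd prime factor of \<open>k (k + 1)\<close>, different from 3 if \<open>k\<close> is 2 or 6 modulo 9.

  Let \<open>m\<close> be the discriminator of the first \<open>n\<close> terms and suppose that \<open>m\<close> lies in neither
  \<open>A_set k\<close> nor \<open>B_set k\<close>. Then two terms with indices at most \<open>2 m / 3\<close> agree modulo \<open>m\<close>
  (\<open>collision_outside\<close>), so \<open>n \<le> 2 m / 3\<close>. On the other hand each number \<open>M = 2 ^ e * q ^ f\<close> with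
  \<open>e \<ge> 1\<close> separates the first \<open>M\<close> terms (\<open>two_mult_prime_power_discriminates\<close>). Hence no such \<open>M\<close>
  satisfies \<open>2 m / 3 \<le> M < m\<close>: it would separate the first \<open>n\<close> terms and be smaller than \<open>m\<close>.
  But the ratio \<open>3 / 2\<close> is generous. One of the two powers of 2 next to \<open>q\<close> differs from
  \<open>q\<close> by a factor of at most \<open>3 / 2\<close>, and exchanging one for the other step by step leads into
  the interval as soon as \<open>m > 2 * q ^ q\<close> (\<open>two_power_times_power_in_interval\<close>).

  Both arithmetic facts rest on \<open>U k (r * n) = U k r * U k' n\<close> (\<open>U_mult\<close>): along multiples of
  \<open>r\<close> the sequence is a multiple of another member of the same family, with
  \<open>k' (k' + 1) = k (k + 1) (U k r)\<^sup>2\<close>. This reduces divisibility by a composite modulus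
  to divisibility by one prime at a time.

  Throughout, write \<open>\<beta> = \<surd>(k + 1) + \<surd>k\<close> and \<open>\<alpha> = \<beta>\<^sup>2\<close>. Then
  \<open>U k n = (\<alpha> ^ n - \<alpha> ^ -n) / (\<alpha> - \<alpha> ^ -1)\<close>, and \<open>U k (n + 1) \<plusminus> U k n\<close> are the coordinates of
  \<open>\<beta> ^ (2 n + 1)\<close> with respect to \<open>\<surd>k\<close> and \<open>\<surd>(k + 1)\<close>.\<close>

section \<open>Product formulas and composition\<close>

lemma U_add_Suc: "U k (m + n + 1) = U k (m + 1) * U k (n + 1) - U k m * U k n"
proof (induction n rule: induct_nat_012)
  case (ge2 n)
  have "U k (m + Suc (Suc n) + 1)
      = (4 * int k + 2) * U k (m + Suc n + 1) - U k (m + n + 1)" by simp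
  then show ?case
    unfolding ge2 by (simp add: algebra_simps)
qed simp_all

lemma U_add:
  "U k (m + n) = U k m * U k (n + 1) + U k (m + 1) * U k n - (4 * int k + 2) * U k m * U k n"
proof (cases m)
  case (Suc l)
  have "U k (m + n) = U k (l + n + 1)" using Suc by simp
  also have "\<dots> = U k m * U k (n + 1) - U k l * U k n"
    unfolding U_add_Suc using Suc by simp
  also have "U k l = (4 * int k + 2) * U k m - U k (m + 1)"
    using Suc by simp
  finally show ?thesis by (simp add: algebra_simps)
qed simp

text \<open>The norm of \<open>\<alpha> ^ n\<close> is 1.\<close>

lemma U_invariant: "(U k (n + 1))\<^sup>2 - (4 * int k + 2) * U k n * U k (n + 1) + (U k n)\<^sup>2 = 1"
proof (induction n)
  case (Suc n)
  have "U k (Suc n + 1) = (4 * int k + 2) * U k (n + 1) - U k n" by simp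
  then show ?case using Suc
    by (simp add: power2_eq_square algebra_simps)
qed simp

text \<open>The companion sequence \<open>\<alpha> ^ n + \<alpha> ^ -n\<close>.\<close>

definition companion :: "nat \<Rightarrow> nat \<Rightarrow> int" where
  "companion k n = 2 * U k (n + 1) - (4 * int k + 2) * U k n"

lemma companion_square: "(companion k n)\<^sup>2 = 4 + 16 * int k * (int k + 1) * (U k n)\<^sup>2"
  using U_invariant[of k n] unfolding companion_def by Groebner_Basis.algebra

text \<open>Differences of terms factor. Which of the two factorizations applies depends on the parity of
  the difference of the indices: for odd parity, the half-integral powers of \<open>\<alpha>\<close> are powers of \<open>\<beta>\<close>.\<close>

lemma U_diff_even: "U k (y + 2 * s) - U k y = U k s * companion k (y + s)"
proof -
  define P where "P = 4 * int k + 2"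
  have e: "y + 2 * s = (y + s) + s" by simp
  show ?thesis
    using U_invariant[of k s] unfolding e U_add[of k "y + s" s] companion_def U_add_Suc U_add[of k y s]
    unfolding P_def[symmetric] by Groebner_Basis.algebra
qed

lemma U_diff_odd:
  "U k (y + 2 * s + 1) - U k y = (U k (s + 1) + U k s) * (U k (y + s + 1) - U k (y + s))"
proof -
  define P where "P = 4 * int k + 2"
  have e: "y + 2 * s = (y + s) + s" by simp
  show ?thesis
    using U_invariant[of k s] unfolding e U_add_Suc[of k "y + s" s] U_add_Suc U_add[of k y s]
    unfolding P_def[symmetric] by Groebner_Basis.algebra
qed

lemma U_step: "U k (y + 2 * r) = companion k r * U k (y + r) - U k y"
proof -
  define P where "P = 4 * int k + 2"
  have e: "y + 2 * r = (y + r) + r" by simp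
  show ?thesis
    using U_invariant[of k r] unfolding e U_add[of k "y + r" r] companion_def U_add_Suc U_add[of k y r]
    unfolding P_def[symmetric] by Groebner_Basis.algebra
qed

text \<open>By induction along the recurrence, which preserves the residue 2 modulo 4; the inequality keeps
  the next value nonnegative. A number \<open>4 a + 2\<close> is the recurrence coefficient of \<open>U a\<close>.\<close>

lemma companion_form: "\<exists>a b. companion k r = 4 * int a + 2 \<and> companion k (r + 1) = 4 * int b + 2 \<and> a \<le> b"
proof (induction r)
  case 0
  have "companion k 0 = 4 * int 0 + 2" "companion k (0 + 1) = 4 * int k + 2"
    by (simp_all add: companion_def algebra_simps)
  then show ?case by blast
next
  case (Suc r)
  then obtain a b where ab: "companion k r = 4 * int a + 2" "companion k (r + 1) = 4 * int b + 2" "a \<le> b"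
    by blast
  define c where "c = 4 * k * b + b + 2 * k + (b - a)"
  have "companion k (r + 2) = (4 * int k + 2) * companion k (r + 1) - companion k r"
    by (simp add: companion_def algebra_simps)
  also have "\<dots> = 4 * int c + 2"
    unfolding ab c_def using ab(3) by (simp add: of_nat_diff algebra_simps)
  finally show ?case using ab(2) c_def by (intro exI[of _ b] exI[of _ c]) simp
qed

text \<open>The terms with index divisible by \<open>r\<close> satisfy the recurrence with coefficient \<open>companion k r\<close>, which is
  of the form \<open>4 k' + 2\<close>; so they form a multiple of \<open>U k'\<close>. The second equation compares
  discriminants, and shows that primes dividing \<open>k (k + 1)\<close> keep this property for \<open>k'\<close>.\<close>

lemma U_mult:
  obtains k' where "\<And>n. U k (r * n) = U k r * U k' n"
    and "int k' * (int k' + 1) = int k * (int k + 1) * (U k r)\<^sup>2"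
proof -
  obtain k' where k': "companion k r = 4 * int k' + 2" using companion_form by blast
  have "U k (r * n) = U k r * U k' n" for n
  proof (induction n rule: induct_nat_012)
    case (ge2 n)
    have "r * Suc (Suc n) = r * n + 2 * r" "r * n + r = r * Suc n" by simp_all
    then have "U k (r * Suc (Suc n)) = companion k r * U k (r * Suc n) - U k (r * n)"
      using U_step[of k "r * n" r] by (simp only:)
    then show ?case unfolding ge2 k' by (simp add: algebra_simps)
  qed simp_all
  moreover have "int k' * (int k' + 1) = int k * (int k + 1) * (U k r)\<^sup>2"
    using companion_square[of k r] unfolding k' by (simp add: power2_eq_square algebra_simps)
  ultimately show ?thesis using that by blast
qed

text \<open>The norm of \<open>\<beta> ^ (2 n + 1)\<close>. A prime factor of \<open>k\<close> cannot divide the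
  coordinate \<open>U k (n + 1) - U k n\<close>, nor a prime factor of \<open>k + 1\<close> the other one.\<close>

lemma U_norm_equation:
  "(int k + 1) * (U k (n + 1) - U k n)\<^sup>2 - int k * (U k (n + 1) + U k n)\<^sup>2 = 1"
proof -
  have "(int k + 1) * (U k (n + 1) - U k n)\<^sup>2 - int k * (U k (n + 1) + U k n)\<^sup>2
      = (U k (n + 1))\<^sup>2 - (4 * int k + 2) * U k n * U k (n + 1) + (U k n)\<^sup>2"
    by (simp add: power2_eq_square algebra_simps)
  then show ?thesis using U_invariant by simp
qed

section \<open>The sequence modulo prime factors of the discriminant\<close>

text \<open>Modulo a divisor of \<open>k\<close> the characteristic polynomial is \<open>(X - 1)\<^sup>2\<close>, modulo a divisor of
  \<open>k + 1\<close> it is \<open>(X + 1)\<^sup>2\<close>; the solutions are linear in \<open>n\<close> up to sign.\<close>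

lemma U_cong_index: "int k dvd U k n - int n"
proof (induction n rule: induct_nat_012)
  case (ge2 n)
  have "U k (Suc (Suc n)) - int (Suc (Suc n))
     = (4 * int k + 2) * (U k (Suc n) - int (Suc n)) - (U k n - int n) + int k * (4 * int (Suc n))"
    by (simp add: algebra_simps)
  then show ?case using ge2 by (metis dvd_add dvd_diff dvd_mult dvd_triv_left)
qed simp_all

lemma U_cong_index': "int k + 1 dvd (-1) ^ n * U k n + int n"
proof (induction n rule: induct_nat_012)
  case (ge2 n)
  have "(-1) ^ Suc (Suc n) * U k (Suc (Suc n)) + int (Suc (Suc n))
     = - (4 * int k + 2) * ((-1) ^ Suc n * U k (Suc n) + int (Suc n)) - ((-1) ^ n * U k n + int n)
       + (int k + 1) * (4 * int (Suc n))"
    by (simp add: algebra_simps)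
  then show ?case using ge2 by (metis dvd_add dvd_diff dvd_mult dvd_triv_left)
qed simp_all

lemma prime_dvd_U_iff:
  assumes "prime p" "p dvd k * (k + 1)"
  shows "int p dvd U k n \<longleftrightarrow> p dvd n"
proof -
  have "p dvd k \<or> p dvd k + 1" using assms prime_dvd_mult_iff by blast
  then show ?thesis
  proof
    assume "p dvd k"
    then have "int p dvd int k" by simp
    then have "int p dvd U k n - int n" using U_cong_index dvd_trans by blast
    then have "int p dvd U k n \<longleftrightarrow> int p dvd int n"
      by (metis dvd_diff_commute dvd_diff_right_iff dvd_minus_iff)
    then show ?thesis by simp
  next
    assume "p dvd k + 1"
    then have "int p dvd int k + 1" by (metis of_nat_1 of_nat_add int_dvd_int_iff)
    then have *: "int p dvd (-1) ^ n * U k n + int n" using U_cong_index' dvd_trans by blast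
    have "int p dvd U k n \<longleftrightarrow> int p dvd (-1) ^ n * U k n"
      by (cases "even n") simp_all
    also have "\<dots> \<longleftrightarrow> int p dvd int n" using * by (metis dvd_add_right_iff dvd_add_left_iff)
    finally show ?thesis by simp
  qed
qed

lemma dvd_index_product_iff: "q dvd k * (k + 1) \<longleftrightarrow> int q dvd int k * (int k + 1)"
  by (metis int_dvd_int_iff of_nat_1 of_nat_add of_nat_mult)

lemma U_3: "U k 3 = 16 * int k * (int k + 1) + 3"
  by (simp add: numeral_3_eq_3 algebra_simps)

text \<open>The source of the exceptional residues of \<open>k\<close> modulo 9: in these two cases already \<open>U k 3\<close> is
  divisible by 9, so that 9 behaves worse than the square of any other prime factor of \<open>k (k + 1)\<close>.\<close>

lemma nine_dvd_U_3_iff: "9 dvd U k 3 \<longleftrightarrow> k mod 9 = 2 \<or> k mod 9 = 6"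
proof -
  define r where "r = k mod 9"
  define c where "c = k div 9"
  have k: "k = 9 * c + r" unfolding r_def c_def by simp
  have "U k 3 = 9 * (16 * (9 * int c * int c + 2 * int c * int r + int c)) + (16 * int r * (int r + 1) + 3)"
    unfolding U_3 k by (simp add: algebra_simps)
  then have "9 dvd U k 3 \<longleftrightarrow> 9 dvd 16 * int r * (int r + 1) + 3"
    by (simp only: dvd_add_right_iff dvd_triv_left)
  moreover have "r < 9" unfolding r_def by simp
  then have "r \<in> {0,1,2,3,4,5,6,7,8}" by auto
  ultimately show ?thesis unfolding r_def[symmetric] by auto
qed

text \<open>One prime factor \<open>p\<close> is split off \<open>m\<close> at a time, using \<open>p dvd U k p\<close>.\<close>

lemma U_dvd_of_smooth:
  assumes "m > 0" "\<And>p. prime p \<Longrightarrow> p dvd m \<Longrightarrow> p dvd k * (k + 1)"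
  shows "int m dvd U k m"
  using assms
proof (induction m arbitrary: k rule: less_induct)
  case (less m)
  show ?case
  proof (cases "m = 1")
    case False
    then obtain p where p: "prime p" "p dvd m" using prime_factor_nat by blast
    then obtain m' where m: "m = p * m'" by blast
    obtain k' where k': "\<And>n. U k (p * n) = U k p * U k' n"
      "int k' * (int k' + 1) = int k * (int k + 1) * (U k p)\<^sup>2"
      using U_mult[of k p] by metis
    have "int m' dvd U k' m'"
    proof (rule less.IH)
      show "m' < m" "m' > 0" using m less.prems(1) prime_gt_1_nat[OF p(1)] by auto
      fix r assume r: "prime r" "r dvd m'"
      then have "r dvd k * (k + 1)" using less.prems(2) m by simp
      then have "int r dvd int k' * (int k' + 1)"
        unfolding k'(2) using dvd_index_product_iff by simp
      then show "r dvd k' * (k' + 1)" using dvd_index_product_iff by blast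
    qed
    moreover have "int p dvd U k p" using prime_dvd_U_iff[OF p(1)] less.prems(2)[OF p] by simp
    ultimately show ?thesis unfolding m k'(1) by (simp add: mult_dvd_mono)
  qed simp
qed

section \<open>Zeros modulo the other primes\<close>

text \<open>For \<open>x = \<surd>(k + 1)\<close> the signs \<open>y = \<plusminus>\<surd>k\<close> give \<open>\<beta>\<close> and its inverse.\<close>

lemma sqrt_power_odd:
  fixes x y :: real
  assumes x: "x * x = real k + 1" and y: "y * y = real k"
  shows "(x + y) ^ (2 * j + 1)
       = x * of_int (U k (j + 1) - U k j) + y * of_int (U k (j + 1) + U k j)"
proof (induction j)
  case (Suc j)
  define A where "A = real_of_int (U k (j + 1))"
  define B where "B = real_of_int (U k j)"
  have "(x + y) ^ (2 * Suc j + 1) = (x + y) ^ (2 * j + 1) * ((x + y) * (x + y))"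
    by (simp add: mult_ac)
  also have "\<dots> = (x * (A - B) + y * (A + B)) * ((x + y) * (x + y))"
    unfolding Suc A_def B_def by simp
  also have "\<dots> = x * ((4 * real k + 2) * A - B - A) + y * ((4 * real k + 2) * A - B + A)"
  proof -
    have "(x * C + y * D) * ((x + y) * (x + y))
        = x * (C * (x * x + y * y) + 2 * (y * y) * D) + y * (D * (x * x + y * y) + 2 * (x * x) * C)" for C D
      by (simp add: algebra_simps)
    note expand = this
    show ?thesis unfolding expand x y by (simp add: algebra_simps)
  qed
  finally show ?case unfolding A_def B_def by simp
qed simp

text \<open>By the binomial theorem \<open>\<beta> ^ p\<close> is congruent to \<open>\<surd>(k + 1) ^ p + \<surd>k ^ p\<close> modulo \<open>p\<close>; this
  is the comparison of the coordinates at \<open>\<surd>k\<close>, extracted by subtracting the conjugate power.\<close>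

lemma U_half_cong_power:
  assumes p: "prime p" "p = 2 * h + 1" and k: "k > 0"
  shows "int p dvd (U k (h + 1) + U k h) - int k ^ h"
proof -
  define x where "x = sqrt (real k + 1)"
  define y where "y = sqrt (real k)"
  have x: "x * x = real k + 1" and y: "y * y = real k" "y > 0"
    using k unfolding x_def y_def by simp_all
  define b where "b = U k (h + 1) + U k h"
  have xe: "x ^ (2 * n) = real (k + 1) ^ n" and ye: "y ^ (2 * n) = real k ^ n" for n
    using x y unfolding power_mult power2_eq_square by (simp_all add: add.commute)
  define F where "F i = real (p choose i) * x ^ i * (y ^ (p - i) - (- y) ^ (p - i))" for i
  have "2 * y * of_int b = (x + y) ^ p - (x + (- y)) ^ p"
    unfolding p(2) b_def using sqrt_power_odd[OF x y(1), of h] sqrt_power_odd[OF x, of "-y" h] y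
    by (simp add: algebra_simps)
  also have "\<dots> = (\<Sum>i\<le>p. F i)"
    unfolding binomial_ring F_def by (simp add: sum_subtractf[symmetric] algebra_simps)
  also have "\<dots> = F 0 + (\<Sum>i\<in>{1..p}. F i)"
    by (simp add: atMost_atLeast0 sum.atLeast_Suc_atMost)
  also have "F 0 = 2 * y * real k ^ h"
    unfolding F_def p(2) using ye[of h] by simp
  finally have sum: "2 * y * of_int b = 2 * y * real k ^ h + (\<Sum>i\<in>{1..p}. F i)" .
  \<comment> \<open>The inner binomial coefficients supply the factor \<open>p\<close>; for odd \<open>i\<close> the conjugate terms cancel.\<close>
  have "\<exists>z. F i = 2 * y * of_int (int p * z)" if "i \<in> {1..p}" for i
  proof (cases "even i")
    case False
    then have "even (p - i)" using p(2) that by simp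
    then show ?thesis by (intro exI[of _ 0]) (simp add: F_def)
  next
    case True
    then have "i < p" using that p(2) by (cases "i = p") auto
    then have "p dvd p choose i" using that p(1) by (intro dvd_choose_prime) auto
    then obtain c where c: "p choose i = p * c" by blast
    obtain r where r: "i = 2 * r" using True by blast
    have e: "p - i = 2 * (h - r) + 1" using r p(2) \<open>i < p\<close> by simp
    have "y ^ (p - i) - (- y) ^ (p - i) = 2 * y * real k ^ (h - r)"
      unfolding e using ye[of "h - r"] by simp
    then have "F i = 2 * y * of_int (int p * (int c * int (k + 1) ^ r * int k ^ (h - r)))"
      unfolding F_def c unfolding r xe by simp
    then show ?thesis by blast
  qed
  then obtain z where z: "\<And>i. i \<in> {1..p} \<Longrightarrow> F i = 2 * y * of_int (int p * z i)" by metis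
  have "(\<Sum>i\<in>{1..p}. F i) = 2 * y * of_int (int p * (\<Sum>i\<in>{1..p}. z i))"
    using z by (simp add: sum_distrib_left)
  then have "2 * y * (of_int b - (real k ^ h + of_int (int p * (\<Sum>i\<in>{1..p}. z i)))) = 0"
    using sum by (simp add: algebra_simps)
  then have "real_of_int b = of_int (int k ^ h + int p * (\<Sum>i\<in>{1..p}. z i))"
    using y(2) by simp
  then have "b = int k ^ h + int p * (\<Sum>i\<in>{1..p}. z i)" by (simp only: of_int_eq_iff)
  then show ?thesis unfolding b_def by simp
qed

text \<open>By Fermat's theorem the square of \<open>k ^ h\<close> is 1 modulo \<open>p = 2 h + 1\<close>, so by the norm equation both
  coordinates of \<open>\<beta> ^ p\<close> have square 1. The difference of these squares is
  \<open>4 * U k h * U k (h + 1)\<close>. An index of at most \<open>(p + 1) / 2\<close>, half of the bound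
  \<open>p + 1\<close> common to all Lucas sequences, is what makes these primes useless for large discriminators.\<close>

lemma prime_dvd_U_half:
  assumes p: "prime p" "odd p" "\<not> p dvd k * (k + 1)"
  obtains c where "c \<ge> 1" "2 * c \<le> p + 1" "int p dvd U k c"
proof -
  obtain h where h: "p = 2 * h + 1" using p(2) by (blast elim: oddE)
  have h1: "h \<ge> 1" using h prime_gt_1_nat[OF p(1)] by simp
  have ip: "prime (int p)" using p(1) by simp
  have nk: "\<not> int p dvd int k" using p(3) by auto
  have nk1: "\<not> int p dvd int k + 1" using p(3) by (metis dvd_mult int_dvd_int_iff of_nat_1 of_nat_add)
  have "k > 0" using p(3) by (cases k) auto
  define a where "a = U k (h + 1) - U k h"
  define b where "b = U k (h + 1) + U k h"
  have "[b = int k ^ h] (mod int p)"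
    using U_half_cong_power[OF p(1) h \<open>k > 0\<close>] unfolding b_def cong_iff_dvd_diff .
  then have "[b\<^sup>2 = (int k ^ h)\<^sup>2] (mod int p)" by (rule cong_pow)
  moreover have "[k ^ (p - 1) = 1] (mod p)"
    using fermat_theorem p(1) nk by simp
  then have "[int k ^ (p - 1) = 1] (mod int p)" by (metis cong_int_iff of_nat_1 of_nat_power)
  then have "[(int k ^ h)\<^sup>2 = 1] (mod int p)" using h by (simp add: power_mult[symmetric] mult.commute)
  ultimately have "[b\<^sup>2 = 1] (mod int p)" by (rule cong_trans)
  then have b: "int p dvd b\<^sup>2 - 1" by (simp add: cong_iff_dvd_diff)
  have "(int k + 1) * (a\<^sup>2 - 1) = int k * (b\<^sup>2 - 1)"
    using U_norm_equation[of k h] unfolding a_def b_def by (simp add: algebra_simps)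
  then have "int p dvd (int k + 1) * (a\<^sup>2 - 1)" using b by simp
  then have "int p dvd a\<^sup>2 - 1" using nk1 prime_dvd_mult_iff[OF ip] by blast
  with b have "int p dvd (b\<^sup>2 - 1) - (a\<^sup>2 - 1)" by (rule dvd_diff)
  also have "\<dots> = 2 ^ 2 * (U k h * U k (h + 1))"
    unfolding a_def b_def by (simp add: power2_eq_square algebra_simps)
  finally have "int p dvd 2 ^ 2 \<or> int p dvd U k h * U k (h + 1)"
    using prime_dvd_mult_iff[OF ip] by blast
  moreover have "\<not> int p dvd 2 ^ 2"
  proof
    assume "int p dvd 2 ^ 2"
    then have "int p dvd int 2" using prime_dvd_power[OF ip, of 2 2] by simp
    then have "p dvd 2" using int_dvd_int_iff by blast
    then show False using p(1,2) primes_dvd_imp_eq[of p 2] by simp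
  qed
  ultimately have "int p dvd U k h \<or> int p dvd U k (h + 1)" using prime_dvd_mult_iff[OF ip] by blast
  then show ?thesis using that[of h] that[of "h + 1"] h h1 by auto
qed

section \<open>Collisions modulo an exceptional number\<close>

text \<open>One prime factor is split off at a time; the index for \<open>m\<close> is the product of the indices for
  its prime factors, taken with respect to changing parameters.\<close>

lemma exists_zero_index:
  assumes "m > 0"
  shows "\<exists>r\<ge>1. r \<le> m \<and> int m dvd U k r"
  using assms
proof (induction m arbitrary: k rule: less_induct)
  case (less m)
  show ?case
  proof (cases "m = 1")
    case True
    then show ?thesis by auto
  next
    case False
    then obtain p where p: "prime p" "p dvd m" using prime_factor_nat by blast
    then obtain m' where m: "m = p * m'" by blast
    have p1: "p > 1" using prime_gt_1_nat[OF p(1)] .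
    have "\<exists>c\<ge>1. c \<le> p \<and> int p dvd U k c"
    proof (cases "p dvd k * (k + 1)")
      case True
      then show ?thesis using prime_dvd_U_iff[OF p(1)] p1 by (intro exI[of _ p]) simp
    next
      case False
      moreover from this have "odd p" using p(1) primes_dvd_imp_eq[of 2 p] by auto
      ultimately obtain c where "c \<ge> 1" "2 * c \<le> p + 1" "int p dvd U k c"
        using prime_dvd_U_half p(1) by metis
      then show ?thesis using p1 by (intro exI[of _ c]) simp
    qed
    then obtain c where c: "c \<ge> 1" "c \<le> p" "int p dvd U k c" by blast
    obtain k' where k': "\<And>n. U k (c * n) = U k c * U k' n"
      using U_mult[of k c] by metis
    have "m' < m" "m' > 0" using m less.prems p1 by auto
    then obtain r where r: "r \<ge> 1" "r \<le> m'" "int m' dvd U k' r" using less.IH by blast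
    have "int m dvd U k (c * r)" unfolding m k' using c(3) r(3) by (simp add: mult_dvd_mono)
    moreover have "c * r \<ge> 1" "c * r \<le> m" unfolding m using c r by (auto intro: mult_le_mono)
    ultimately show ?thesis by blast
  qed
qed

text \<open>A saving at one divisor \<open>d\<close> persists to \<open>m\<close>: with \<open>k'\<close> belonging to the index \<open>c\<close>, the
  complementary divisor divides some \<open>U k' r\<close> with \<open>r \<le> m / d\<close>, and the term with index \<open>c * r\<close>
  collides with \<open>U k 0\<close>.\<close>

lemma collision_of_short_divisor:
  assumes m: "m > 0" "d dvd m" and c: "c \<ge> 1" "3 * c \<le> 2 * d" "int d dvd U k c"
  shows "\<exists>i j. i < j \<and> 3 * j \<le> 2 * m \<and> int m dvd U k j - U k i"
proof -
  obtain m' where m': "m = d * m'" using m(2) by blast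
  obtain k' where k': "\<And>n. U k (c * n) = U k c * U k' n" using U_mult[of k c] by metis
  have "m' > 0" using m m' by auto
  then obtain r where r: "r \<ge> 1" "r \<le> m'" "int m' dvd U k' r" using exists_zero_index by blast
  have "int m dvd U k (c * r) - U k 0" unfolding m' k' using c(3) r(3) by (simp add: mult_dvd_mono)
  moreover have "0 < c * r" using c r by simp
  moreover have "3 * (c * r) \<le> 2 * m"
    using mult_le_mono[OF c(2) r(2)] unfolding m' by (simp add: mult_ac)
  ultimately show ?thesis by blast
qed

lemma coprime_by_common_primes:
  assumes "m > 0" "\<And>p. prime p \<Longrightarrow> p dvd m \<Longrightarrow> \<not> int p dvd x"
  shows "coprime (int m) x"
proof (rule ccontr)
  assume "\<not> coprime (int m) x"
  then have "nat (gcd (int m) x) \<noteq> 1" by (auto simp: coprime_iff_gcd_eq_1)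
  then obtain p where p: "prime p" "p dvd nat (gcd (int m) x)" using prime_factor_nat by blast
  then have "int p dvd int (nat (gcd (int m) x))" using int_dvd_int_iff by blast
  then have "int p dvd gcd (int m) x" by simp
  then have "int p dvd int m" "int p dvd x" by auto
  then show False using assms(2)[OF p(1)] by simp
qed

lemma split_by_primes_of:
  fixes m k :: nat
  assumes "m > 0"
  obtains m1 m2 where "m = m1 * m2" "coprime m1 k" "\<And>p. prime p \<Longrightarrow> p dvd m2 \<Longrightarrow> p dvd k"
  using assms
proof (induction m arbitrary: thesis rule: less_induct)
  case (less m)
  show ?case
  proof (cases "coprime m k")
    case True
    then show ?thesis using less.prems(1)[of m 1] by simp
  next
    case False
    then have "gcd m k \<noteq> 1" by (auto simp: coprime_iff_gcd_eq_1)
    then obtain p where "prime p" "p dvd gcd m k" using prime_factor_nat by blast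
    then have p: "prime p" "p dvd m" "p dvd k" by auto
    then obtain m' where m: "m = p * m'" by blast
    have "m' < m" "m' > 0" using m less.prems(2) prime_gt_1_nat[OF p(1)] by auto
    then obtain m1 m2 where 1: "m' = m1 * m2" "coprime m1 k" "\<And>p. prime p \<Longrightarrow> p dvd m2 \<Longrightarrow> p dvd k"
      using less.IH by metis
    show ?thesis
    proof (rule less.prems(1)[of m1 "p * m2"])
      show "m = m1 * (p * m2)" using m 1(1) by simp
      show "r dvd k" if "prime r" "r dvd p * m2" for r
        using that 1(3) p primes_dvd_imp_eq[of r p] by (auto simp: prime_dvd_mult_iff)
    qed (rule 1)
  qed
qed

text \<open>Write \<open>m = m1 * m2\<close>, where the primes of \<open>m1\<close> divide \<open>k + 1\<close> and those of \<open>m2\<close> divide \<open>k\<close>.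
  Modulo \<open>m1\<close> the sequence is symmetric under \<open>i \<mapsto> m - i\<close>, modulo \<open>m2\<close> it has period \<open>m2\<close>. So the
  indices \<open>(m - m2) / 2\<close> and \<open>(m + m2) / 2\<close> collide modulo \<open>m\<close>, and \<open>m2 \<le> m / 3\<close>. Formally, the
  difference of the two terms factors, one factor being divisible by \<open>m1\<close>, the other by \<open>m2\<close>.\<close>

lemma collision_of_odd_smooth:
  assumes m: "m > 0" "odd m" and smooth: "\<And>p. prime p \<Longrightarrow> p dvd m \<Longrightarrow> p dvd k * (k + 1)"
    and r: "prime r" "r dvd m" "\<not> r dvd k"
  shows "\<exists>i j. i < j \<and> 3 * j \<le> 2 * m \<and> int m dvd U k j - U k i"
proof -
  obtain m1 m2 where split: "m = m1 * m2" "coprime m1 k" "\<And>p. prime p \<Longrightarrow> p dvd m2 \<Longrightarrow> p dvd k"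
    using split_by_primes_of[OF m(1)] by metis
  have pos: "m1 > 0" "m2 > 0" and od: "odd m1" "odd m2" using m split(1) by auto
  have "r dvd m1" using r split prime_dvd_mult_iff[OF r(1)] by blast
  then have "m1 \<noteq> 1" using r(1) by auto
  then have m1: "m1 \<ge> 3" using od pos by presburger
  obtain s where s: "m2 = 2 * s + 1" using od(2) by (blast elim: oddE)
  obtain t where t: "m = 2 * t + 1" using m(2) by (blast elim: oddE)
  have "3 * m2 \<le> m" using m1 split(1) by simp
  then have st: "3 * s + 1 \<le> t" using s t by simp
  have factor: "U k (2 * n + 1) = (U k (n + 1) + U k n) * (U k (n + 1) - U k n)" for n
    using U_diff_odd[of k 0 n] by simp
  have "int m1 dvd U k (t + 1) - U k t"
  proof -
    have "int m dvd U k m" using U_dvd_of_smooth[OF m(1) smooth] .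
    then have "int m1 dvd U k m" using split(1) by (metis dvd_mult_left of_nat_mult)
    moreover have "coprime (int m1) (U k (t + 1) + U k t)"
    proof (rule coprime_by_common_primes[OF pos(1)])
      fix p assume p: "prime p" "p dvd m1"
      then have "\<not> p dvd k" using split(2) by (metis coprime_common_divisor not_prime_unit)
      moreover have "p dvd k * (k + 1)" using smooth p split(1) by (metis dvd_mult2)
      ultimately have "p dvd k + 1" using prime_dvd_mult_iff[OF p(1)] by blast
      then have k1: "int p dvd int k + 1" by (metis int_dvd_int_iff of_nat_1 of_nat_add)
      show "\<not> int p dvd U k (t + 1) + U k t"
      proof
        assume "int p dvd U k (t + 1) + U k t"
        then have "int p dvd (int k + 1) * (U k (t + 1) - U k t)\<^sup>2 - int k * (U k (t + 1) + U k t)\<^sup>2"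
          using k1 by (intro dvd_diff dvd_mult dvd_mult2 dvd_power) (auto simp: power2_eq_square)
        then show False unfolding U_norm_equation using p(1) by auto
      qed
    qed
    ultimately show ?thesis unfolding t factor by (simp add: coprime_dvd_mult_right_iff)
  qed
  moreover have "int m2 dvd U k (s + 1) + U k s"
  proof -
    have "int m2 dvd U k m2" using U_dvd_of_smooth[OF pos(2)] smooth split(1) by simp
    moreover have "coprime (int m2) (U k (s + 1) - U k s)"
    proof (rule coprime_by_common_primes[OF pos(2)])
      fix p assume p: "prime p" "p dvd m2"
      then have k: "int p dvd int k" using split(3) by simp
      show "\<not> int p dvd U k (s + 1) - U k s"
      proof
        assume "int p dvd U k (s + 1) - U k s"
        then have "int p dvd (int k + 1) * (U k (s + 1) - U k s)\<^sup>2 - int k * (U k (s + 1) + U k s)\<^sup>2"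
          using k by (intro dvd_diff) (auto simp: power2_eq_square)
        then show False unfolding U_norm_equation using p(1) by auto
      qed
    qed
    ultimately show ?thesis unfolding s factor by (simp add: coprime_dvd_mult_left_iff)
  qed
  ultimately have "int m dvd (U k (s + 1) + U k s) * (U k (t - s + s + 1) - U k (t - s + s))"
    unfolding split(1) using st by (simp add: mult_dvd_mono mult.commute)
  then have "int m dvd U k (t - s + 2 * s + 1) - U k (t - s)" unfolding U_diff_odd .
  moreover have "3 * (t - s + 2 * s + 1) \<le> 2 * m" using st t by simp
  ultimately show ?thesis by (intro exI[of _ "t - s"] exI[of _ "t - s + 2 * s + 1"]) simp
qed

text \<open>There are three ways to lie outside both sets: a prime factor outside \<open>k (k + 1)\<close>, the factor
  9 in the exceptional residue classes of \<open>k\<close>, or an odd number with a prime factor from \<open>k + 1\<close>.\<close>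

lemma collision_outside:
  assumes m: "m > 0" "m \<notin> A_set k \<union> B_set k"
  shows "\<exists>i j. i < j \<and> 3 * j \<le> 2 * m \<and> int m dvd U k j - U k i"
proof (cases "\<exists>p. prime p \<and> p dvd m \<and> \<not> p dvd k * (k + 1)")
  case True
  then obtain p where p: "prime p" "p dvd m" "\<not> p dvd k * (k + 1)" by blast
  then have "p \<noteq> 2" by auto
  then have "p > 2" using prime_ge_2_nat[OF p(1)] by simp
  then have "odd p" using p(1) prime_odd_nat by blast
  then obtain c where c: "c \<ge> 1" "2 * c \<le> p + 1" "int p dvd U k c"
    using prime_dvd_U_half p by metis
  moreover have "3 * c \<le> 2 * p" using c(2) \<open>p > 2\<close> by simp
  ultimately show ?thesis using collision_of_short_divisor[OF m(1) p(2)] by blast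
next
  case False
  then have smooth: "p dvd k * (k + 1)" if "prime p" "p dvd m" for p using that by blast
  show ?thesis
  proof (cases "9 dvd m \<and> (k mod 9 = 2 \<or> k mod 9 = 6)")
    case True
    then have "int 9 dvd U k 3" using nine_dvd_U_3_iff[of k] by simp
    then show ?thesis using collision_of_short_divisor[OF m(1), of 9 3] True by simp
  next
    case False
    then have "odd m" using m smooth unfolding B_set_def by (auto split: if_splits)
    then obtain r where "prime r" "r dvd m" "\<not> r dvd k"
      using m False unfolding A_set_def by (auto split: if_splits)
    then show ?thesis using collision_of_odd_smooth[OF m(1) \<open>odd m\<close> smooth] by blast
  qed
qed

section \<open>Moduli that separate as many terms as possible\<close>

text \<open>The prime factors \<open>q\<close> of \<open>k (k + 1)\<close> for which \<open>U k n\<close> and \<open>n\<close> have the same \<open>q\<close>-adic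
  valuation; compare \<open>nine_dvd_U_3_iff\<close>.\<close>

definition regular_prime :: "nat \<Rightarrow> nat \<Rightarrow> bool" where
  "regular_prime k q \<longleftrightarrow>
     prime q \<and> q dvd k * (k + 1) \<and> (q = 3 \<longrightarrow> k mod 9 \<noteq> 2 \<and> k mod 9 \<noteq> 6)"

text \<open>First-order expansions of \<open>U k n\<close> around \<open>k = 0\<close> and \<open>k = -1\<close>. The factor 6 clears the
  denominator of the binomial coefficient \<open>(n + 1) choose 3\<close> in the linear term.\<close>

lemma U_expansion_at_zero:
  "(int k)\<^sup>2 dvd 6 * U k n - (6 * int n + 4 * int k * ((int n + 1) * int n * (int n - 1)))"
proof (induction n rule: induct_nat_012)
  case (ge2 n)
  define F where "F n = 6 * int n + 4 * int k * ((int n + 1) * int n * (int n - 1))" for n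
  have "6 * U k (Suc (Suc n)) - F (Suc (Suc n))
     = (4 * int k + 2) * (6 * U k (Suc n) - F (Suc n)) - (6 * U k n - F n)
       + (int k)\<^sup>2 * (16 * ((int n + 2) * (int n + 1) * int n))"
    unfolding F_def by (simp add: algebra_simps power2_eq_square)
  then show ?case using ge2 unfolding F_def by (metis dvd_add dvd_diff dvd_mult dvd_triv_left)
qed simp_all

lemma U_expansion_at_minus_one:
  "(int k + 1)\<^sup>2 dvd (-1) ^ n * 6 * U k n + (6 * int n - 4 * (int k + 1) * ((int n + 1) * int n * (int n - 1)))"
proof (induction n rule: induct_nat_012)
  case (ge2 n)
  define F where "F n = 6 * int n - 4 * (int k + 1) * ((int n + 1) * int n * (int n - 1))" for n
  have "(-1) ^ Suc (Suc n) * 6 * U k (Suc (Suc n)) + F (Suc (Suc n))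
     = - (4 * int k + 2) * ((-1) ^ Suc n * 6 * U k (Suc n) + F (Suc n)) - ((-1)^n * 6 * U k n + F n)
       - (int k + 1)\<^sup>2 * (16 * ((int n + 2) * (int n + 1) * int n))"
    unfolding F_def by (simp add: algebra_simps power2_eq_square)
  then show ?case using ge2 unfolding F_def by (metis dvd_add dvd_diff dvd_mult dvd_triv_left)
qed simp_all

text \<open>For \<open>q > 3\<close> the expansions give \<open>6 * U k q\<close> congruent to \<open>6 q\<close>, up to sign, modulo \<open>q\<^sup>2\<close>,
  since the linear term has one factor \<open>q\<close> from \<open>k\<close> or \<open>k + 1\<close> and one from the binomial coefficient.\<close>

lemma prime_square_not_dvd_U:
  assumes "regular_prime k q"
  shows "\<not> int q ^ 2 dvd U k q"
proof
  assume a: "int q ^ 2 dvd U k q"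
  have q: "prime q" "q dvd k * (k + 1)" using assms unfolding regular_prime_def by auto
  consider "q = 2" | "q = 3" | "q > 3"
    using prime_ge_2_nat[OF q(1)] by linarith
  then show False
  proof cases
    case 1
    then have "4 dvd 2 * (2 * int k + 1)" using a by (simp add: numeral_2_eq_2)
    then show False by presburger
  next
    case 2
    then show False using a assms nine_dvd_U_3_iff[of k] unfolding regular_prime_def by auto
  next
    case 3
    have q0: "q > 0" using 3 by simp
    have sq: "int q ^ 2 dvd c * ((int q + 1) * int q * (int q - 1))" if "int q dvd c" for c
    proof -
      have "int q * int q dvd c * (int q * ((int q + 1) * (int q - 1)))"
        using that by (intro mult_dvd_mono) auto
      then show ?thesis by (simp add: power2_eq_square mult_ac)
    qed
    have "q dvd k \<or> q dvd k + 1" using q prime_dvd_mult_iff by blast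
    then have "int q ^ 2 dvd 6 * int q"
    proof
      assume "q dvd k"
      then have d: "int q dvd int k" by simp
      have "int q ^ 2 dvd 6 * U k q - (6 * int q + 4 * int k * ((int q + 1) * int q * (int q - 1)))"
        using U_expansion_at_zero dvd_trans dvd_power_same[OF d] by blast
      moreover have "int q ^ 2 dvd 6 * U k q" using a by simp
      moreover have "int q ^ 2 dvd 4 * int k * ((int q + 1) * int q * (int q - 1))"
        by (rule sq) (use d in simp)
      ultimately show ?thesis by (simp add: dvd_diff_right_iff dvd_add_left_iff)
    next
      assume "q dvd k + 1"
      then have d: "int q dvd int k + 1" by (metis of_nat_1 of_nat_add int_dvd_int_iff)
      have "int q ^ 2 dvd (-1) ^ q * 6 * U k q + (6 * int q - 4 * (int k + 1) * ((int q + 1) * int q * (int q - 1)))"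
        using U_expansion_at_minus_one dvd_trans dvd_power_same[OF d] by blast
      moreover have "int q ^ 2 dvd (-1) ^ q * 6 * U k q" using a by simp
      moreover have "int q ^ 2 dvd 4 * (int k + 1) * ((int q + 1) * int q * (int q - 1))"
        by (rule sq) (rule dvd_mult[OF d])
      ultimately show ?thesis by (simp add: dvd_add_right_iff dvd_diff_left_iff)
    qed
    then have "int q dvd 6" using q0 by (simp add: power2_eq_square)
    then have "q dvd 6" by (metis int_dvd_int_iff of_nat_numeral)
    then have "q dvd 2 * 3" by simp
    then have "q dvd 2 \<or> q dvd 3" using prime_dvd_mult_iff[OF q(1)] by blast
    then show False using 3 by (auto dest: dvd_imp_le)
  qed
qed

text \<open>Here \<open>q dvd n\<close>, and splitting off this factor removes exactly one \<open>q\<close> from \<open>U k n\<close>. The new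
  parameter satisfies \<open>q ^ 3 dvd k' * (k' + 1)\<close>, so \<open>q\<close> stays regular for it, even if \<open>q = 3\<close>.\<close>

lemma prime_power_dvd_U:
  assumes "regular_prime k q" "int q ^ j dvd U k n"
  shows "q ^ j dvd n"
  using assms
proof (induction j arbitrary: k n)
  case (Suc j)
  have q: "prime q" "q dvd k * (k + 1)" using Suc.prems unfolding regular_prime_def by auto
  have q0: "q > 0" using q(1) prime_gt_0_nat by blast
  have "int q dvd U k n" using Suc.prems(2) by (metis dvd_trans dvd_triv_left power_Suc)
  then have "q dvd n" using prime_dvd_U_iff[OF q] by blast
  then obtain n' where n: "n = q * n'" by blast
  obtain k' where k': "\<And>n. U k (q * n) = U k q * U k' n"
    "int k' * (int k' + 1) = int k * (int k + 1) * (U k q)\<^sup>2"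
    using U_mult[of k q] by metis
  have qU: "int q dvd U k q" using prime_dvd_U_iff[OF q] by simp
  then obtain w where w: "U k q = int q * w" by blast
  have w': "\<not> int q dvd w"
    using prime_square_not_dvd_U[OF Suc.prems(1)] unfolding w by (auto simp: power2_eq_square)
  have kk: "int q dvd int k * (int k + 1)" using q(2) dvd_index_product_iff by blast
  have "int q * int q ^ 2 dvd int k * (int k + 1) * (U k q)\<^sup>2"
    by (intro mult_dvd_mono kk dvd_power_same qU)
  then have q3: "int q ^ 3 dvd int k' * (int k' + 1)"
    unfolding k'(2) by (simp add: power3_eq_cube power2_eq_square mult_ac)
  have "regular_prime k' q"
    unfolding regular_prime_def
  proof (intro conjI impI)
    have "int q dvd int k' * (int k' + 1)" using q3 by (rule dvd_trans[rotated]) simp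
    then show "q dvd k' * (k' + 1)" using dvd_index_product_iff by blast
  next
    assume "q = 3"
    \<comment> \<open>The residue of \<open>U k' 3\<close> modulo 9 is then 3.\<close>
    then have "27 dvd int k' * (int k' + 1)" using q3 by simp
    then obtain t where "int k' * (int k' + 1) = 27 * t" by blast
    then have "U k' 3 = 9 * (48 * t) + 3" unfolding U_3 by simp
    then have "\<not> 9 dvd U k' 3" by (simp only: dvd_add_right_iff dvd_triv_left) simp
    then show "k' mod 9 \<noteq> 2" "k' mod 9 \<noteq> 6" using nine_dvd_U_3_iff by auto
  qed (rule q)
  moreover have "int q ^ j dvd U k' n'"
  proof -
    have "int q ^ j dvd w * U k' n'"
      using Suc.prems(2) q0 unfolding n k'(1) w by (simp add: mult.assoc)
    moreover have "coprime (int q ^ j) w"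
      using w' q(1) by (simp add: prime_imp_coprime)
    ultimately show ?thesis by (simp add: coprime_dvd_mult_right_iff)
  qed
  ultimately have "q ^ j dvd n'" by (rule Suc.IH)
  then show ?case unfolding n by simp
qed simp

lemma companion_eq_2_mod_4: obtains a where "companion k n = 2 * (2 * int a + 1)"
  using companion_form[of k n] by (auto simp: algebra_simps)

text \<open>Parity forces colliding indices to differ by an even number \<open>2 s\<close>, so their difference is
  \<open>U k s * companion k t\<close>. Here \<open>companion k t\<close> is prime to \<open>q\<close>, so \<open>q ^ f\<close> divides \<open>U k s\<close>. As \<open>companion k t\<close>
  and \<open>companion k s\<close> are both 2 times an odd number, \<open>2 ^ e\<close> divides \<open>U k s * companion k s = U k (2 * s)\<close>.
  So the modulus divides \<open>2 s\<close>, a positive number smaller than it.\<close>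

lemma two_mult_prime_power_discriminates:
  assumes q: "regular_prime k q" "odd q" and e: "e \<ge> 1"
  shows "pairwise_incong k (2 ^ e * q ^ f) (2 ^ e * q ^ f)"
proof -
  define M where "M = 2 ^ e * q ^ f"
  have two: "regular_prime k 2" unfolding regular_prime_def by simp
  have pq: "prime q" "q dvd k * (k + 1)" using q unfolding regular_prime_def by auto
  have no: "\<not> int M dvd U k x - U k y" if "y < x" "x < M" for x y
  proof
    assume d: "int M dvd U k x - U k y"
    have d2: "int 2 ^ e dvd U k x - U k y" and dq: "int q ^ f dvd U k x - U k y"
      using d unfolding M_def by (auto elim: dvd_mult_left dvd_mult_right)
    have par: "even (U k n) \<longleftrightarrow> even n" for n
      using prime_dvd_U_iff[of 2 k n] by simp
    have "even (U k x - U k y)"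
      using d2 e by (metis dvd_power dvd_trans less_eq_Suc_le One_nat_def of_nat_numeral zero_less_one le_trans)
    then have "even (x - y)" using par that by simp
    then obtain s where s: "x - y = 2 * s" by blast
    then have x: "x = y + 2 * s" using that by simp
    obtain a where a: "companion k s = 2 * (2 * int a + 1)" by (rule companion_eq_2_mod_4)
    obtain b where b: "companion k (y + s) = 2 * (2 * int b + 1)" by (rule companion_eq_2_mod_4)
    have diff: "U k x - U k y = U k s * companion k (y + s)" unfolding x by (rule U_diff_even)
    \<comment> \<open>The odd part of \<open>companion k (y + s)\<close> is exchanged for that of \<open>companion k s\<close>.\<close>
    have "2 ^ e dvd (2 * U k s) * (2 * int b + 1)"
      using d2 unfolding diff b by (simp add: mult_ac)
    moreover have "coprime (2 ^ e) (2 * int b + 1)" by simp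
    ultimately have "2 ^ e dvd 2 * U k s" using coprime_dvd_mult_left_iff by blast
    then have "int 2 ^ e dvd (2 * U k s) * (2 * int a + 1)" by simp
    also have "\<dots> = U k (2 * s)" using U_diff_even[of k 0 s] a by simp
    finally have "2 ^ e dvd 2 * s" using prime_power_dvd_U[OF two] by blast
    moreover have "q ^ f dvd 2 * s"
    proof -
      have "\<not> int q dvd companion k (y + s)"
      proof
        assume "int q dvd companion k (y + s)"
        then have "int q dvd (companion k (y + s))\<^sup>2" by (simp add: power2_eq_square)
        moreover have "int q dvd 16 * (int k * (int k + 1)) * (U k (y + s))\<^sup>2"
          using pq(2) dvd_index_product_iff by (simp del: of_nat_mult)
        ultimately have "int q dvd 4"
          unfolding companion_square by (simp add: mult.assoc dvd_add_left_iff)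
        then have "q dvd 4" by (metis int_dvd_int_iff of_nat_numeral)
        then have "q dvd 2 ^ 2" by simp
        then have "q dvd 2" using pq(1) prime_dvd_power by blast
        then have "q = 2" using pq(1) by (simp add: primes_dvd_imp_eq)
        then show False using q(2) by simp
      qed
      then have "coprime (int q ^ f) (companion k (y + s))"
        using pq(1) by (simp add: prime_imp_coprime)
      then have "int q ^ f dvd U k s"
        using dq unfolding diff by (simp add: coprime_dvd_mult_left_iff)
      then show ?thesis using prime_power_dvd_U[OF q(1)] by simp
    qed
    moreover have "coprime (2 ^ e) (q ^ f)" using q(2) by simp
    ultimately have "M dvd 2 * s" unfolding M_def by (rule divides_mult)
    moreover have "0 < 2 * s" using s that by simp
    ultimately have "M \<le> 2 * s" by (rule dvd_imp_le)
    then show False using that x by simp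
  qed
  show ?thesis
    unfolding pairwise_incong_def M_def[symmetric] cong_iff_dvd_diff
    using no by (metis dvd_diff_commute nat_neq_iff)
qed

lemma prime_factor_gt_3:
  fixes n :: nat
  assumes "odd n" "\<not> 3 dvd n" "n > 1"
  obtains q where "prime q" "q dvd n" "odd q" "q \<noteq> 3"
proof -
  obtain q where q: "prime q" "q dvd n" using prime_factor_nat assms(3) by (metis less_irrefl)
  moreover have "odd q" "q \<noteq> 3" using q assms by (auto elim: dvd_trans)
  ultimately show ?thesis using that by blast
qed

text \<open>Only the exceptional classes of \<open>k\<close> modulo 9 need care. There the odd one of \<open>k\<close> and \<open>k + 1\<close>
  is not divisible by 9, and after removing a factor 3 it is still greater than 1 because \<open>k > 3\<close>.\<close>

lemma exists_odd_regular_prime: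
  assumes k: "k > 3"
  obtains q where "regular_prime k q" "odd q" "q \<le> k + 1"
proof -
  note goal = that
  have found: thesis if "prime q" "q dvd n" "odd q" "n dvd k \<or> n dvd k + 1"
    "q = 3 \<longrightarrow> k mod 9 \<noteq> 2 \<and> k mod 9 \<noteq> 6" for q n
  proof -
    have "q dvd k \<or> q dvd k + 1" using that(2,4) dvd_trans by blast
    then have "q dvd k * (k + 1)" by (metis dvd_mult dvd_mult2)
    moreover have "q \<le> k + 1"
      using \<open>q dvd k \<or> q dvd k + 1\<close> k by (auto dest: dvd_imp_le)
    ultimately show thesis by (intro goal) (use that in \<open>auto simp: regular_prime_def\<close>)
  qed
  define n where "n = (if odd k then k else k + 1)"
  have n: "odd n" "n > 1" "n dvd k \<or> n dvd k + 1" using k unfolding n_def by auto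
  show thesis
  proof (cases "k mod 9 = 2 \<or> k mod 9 = 6")
    case False
    obtain q where "prime q" "q dvd n" using prime_factor_nat n(2) by (metis less_irrefl)
    moreover have "odd q" using n(1) calculation(2) by (auto elim: dvd_trans)
    ultimately show thesis using found n(3) False by blast
  next
    case True
    have "\<exists>u. odd u \<and> \<not> 3 dvd u \<and> u > 1 \<and> u dvd n"
    proof (cases "3 dvd n")
      case False
      then show ?thesis using n(1,2) by (intro exI[of _ n]) simp
    next
      case 3: True
      then obtain u where u: "n = 3 * u" by blast
      have "n mod 9 \<noteq> 0" using True unfolding n_def by (auto simp: mod_Suc)
      then have "\<not> 3 dvd u" unfolding u by auto
      moreover have "odd u" using n(1) u by simp
      moreover have "u \<noteq> 1" using k u unfolding n_def by (auto split: if_splits)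
      ultimately show ?thesis using u n(2) by (intro exI[of _ u]) (auto intro!: Suc_lessI gr0I)
    qed
    then obtain u where u: "odd u" "\<not> 3 dvd u" "u > 1" "u dvd n" by blast
    obtain q where "prime q" "q dvd u" "odd q" "q \<noteq> 3" using prime_factor_gt_3[OF u(1-3)] .
    then show thesis using found n(3) u(4) dvd_trans by blast
  qed
qed

section \<open>Numbers with two prime factors in short intervals\<close>

text \<open>Start with \<open>2 ^ e * a ^ a\<close>, which is below \<open>m\<close> and at least \<open>m / 2\<close>, and replace the factors
  \<open>a\<close> by \<open>b\<close> one after the other. In total this at least doubles the number, by Bernoulli's
  inequality \<open>(1 + 1 / a) ^ a \<ge> 2\<close>, so it passes \<open>m\<close>; as each step multiplies by at most \<open>3 / 2\<close>,
  the last number below \<open>m\<close> is at least \<open>2 m / 3\<close>.\<close>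

lemma geometric_in_interval:
  fixes a b m :: nat
  assumes a: "a > 0" and ab: "a < b" "2 * b \<le> 3 * a" and m: "2 * a ^ a < m"
  obtains e u v where "e \<ge> 1" "2 ^ e * a ^ u * b ^ v < m" "2 * m \<le> 3 * (2 ^ e * a ^ u * b ^ v)"
proof -
  have double: "2 * a ^ a \<le> b ^ a"
  proof -
    have "2 = 1 + real a * (1 / real a)" using a by simp
    also have "\<dots> \<le> (1 + 1 / real a) ^ a"
      by (rule Bernoulli_inequality, rule order_trans[of _ 0]) simp_all
    also have "1 + 1 / real a = real (a + 1) / real a" using a by (simp add: field_simps)
    also have "(real (a + 1) / real a) ^ a = real (a + 1) ^ a / real a ^ a"
      by (rule power_divide)
    finally have "2 * real a ^ a \<le> real (a + 1) ^ a"
      using a by (simp add: field_simps)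
    then have "2 * a ^ a \<le> (a + 1) ^ a"
      by (metis (mono_tags, lifting) of_nat_le_iff of_nat_mult of_nat_numeral of_nat_power)
    also have "\<dots> \<le> b ^ a" by (rule power_mono) (use ab in simp_all)
    finally show ?thesis .
  qed
  define e where "e = (LEAST e. m \<le> 2 ^ (e + 1) * a ^ a)"
  have "m \<le> 2 ^ (m + 1) * a ^ a"
  proof -
    have "m \<le> 2 ^ (m + 1)" by (metis less_exp less_imp_le_nat add.commute le_add2 le_trans)
    also have "\<dots> \<le> 2 ^ (m + 1) * a ^ a" using a by simp
    finally show ?thesis .
  qed
  then have e_le: "m \<le> 2 ^ (e + 1) * a ^ a" unfolding e_def by (rule LeastI)
  have "e \<noteq> 0" using e_le m by (intro notI) simp
  then have e1: "e \<ge> 1" by simp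
  have "\<not> m \<le> 2 ^ (e - 1 + 1) * a ^ a"
    unfolding e_def by (rule not_less_Least) (use e1 in \<open>simp add: e_def\<close>)
  then have e_less: "2 ^ e * a ^ a < m" using e1 by simp
  define x where "x j = 2 ^ e * a ^ (a - j) * b ^ j" for j
  define j where "j = (LEAST j. m \<le> x j)"
  have end_ge: "m \<le> x a"
  proof -
    have "2 ^ (e + 1) * a ^ a = 2 ^ e * (2 * a ^ a)" by simp
    also have "\<dots> \<le> 2 ^ e * b ^ a" using double by (rule mult_le_mono2)
    also have "\<dots> = x a" unfolding x_def by simp
    finally show ?thesis using e_le by (rule le_trans[rotated])
  qed
  then have j_ge: "m \<le> x j" unfolding j_def by (rule LeastI)
  have j_le: "j \<le> a" unfolding j_def using end_ge by (rule Least_le)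
  have "j \<noteq> 0" using j_ge e_less by (intro notI) (simp add: x_def)
  then obtain i where i: "j = Suc i" by (cases j) auto
  have i_less: "x i < m"
  proof (rule ccontr)
    assume "\<not> x i < m"
    then have "j \<le> i" unfolding j_def by (intro Least_le) simp
    with i show False by simp
  qed
  have "a - i = Suc (a - j)" using i j_le by simp
  then have xi: "x i = a * (2 ^ e * a ^ (a - j) * b ^ i)" unfolding x_def by simp
  have xj: "x j = b * (2 ^ e * a ^ (a - j) * b ^ i)" unfolding x_def i by simp
  have "2 * m \<le> 2 * b * (2 ^ e * a ^ (a - j) * b ^ i)" using j_ge unfolding xj by simp
  also have "\<dots> \<le> 3 * a * (2 ^ e * a ^ (a - j) * b ^ i)" using ab(2) by (rule mult_le_mono1)
  finally have "2 * m \<le> 3 * x i" unfolding xi by simp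
  with i_less e1 that show ?thesis unfolding x_def by blast
qed

text \<open>If \<open>2 ^ s < q < 2 ^ (s + 1)\<close>, then \<open>q / 2 ^ s \<le> 3 / 2\<close> or \<open>2 ^ (s + 1) / q \<le> 4 / 3\<close>.\<close>

lemma two_power_times_power_in_interval:
  fixes q m :: nat
  assumes q: "odd q" "q > 1" and m: "2 * q ^ q < m"
  obtains e f where "e \<ge> 1" "2 ^ e * q ^ f < m" "2 * m \<le> 3 * (2 ^ e * q ^ f)"
proof -
  obtain s where s: "2 ^ s \<le> q" "q < 2 ^ (s + 1)"
    using ex_power_ivl1[of 2 q] q by auto
  have s0: "s \<noteq> 0" using s q by (intro notI) simp
  then have ne: "2 ^ s \<noteq> q" using q by auto
  show ?thesis
  proof (cases "2 * q \<le> 3 * 2 ^ s")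
    case True
    have "(2::nat) ^ s > 0" by simp
    have "((2::nat) ^ s) ^ (2 ^ s) \<le> q ^ (2 ^ s)" by (rule power_mono) (use s in simp_all)
    also have "\<dots> \<le> q ^ q" by (rule power_increasing) (use s q in simp_all)
    finally have "2 * (2 ^ s) ^ (2 ^ s) < m" using m by simp
    then obtain e u v where
      "e \<ge> 1" "2 ^ e * (2 ^ s) ^ u * q ^ v < m" "2 * m \<le> 3 * (2 ^ e * (2 ^ s) ^ u * q ^ v)"
      using geometric_in_interval[of "2 ^ s" q m] s ne True by (metis \<open>(2::nat) ^ s > 0\<close> le_neq_implies_less)
    then show ?thesis using that[of "e + s * u" v]
      by (simp add: power_add power_mult)
  next
    case False
    then have "2 * 2 ^ (s + 1) \<le> 3 * q" by simp
    then obtain e u v where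
      "e \<ge> 1" "2 ^ e * q ^ u * (2 ^ (s + 1)) ^ v < m"
      "2 * m \<le> 3 * (2 ^ e * q ^ u * (2 ^ (s + 1)) ^ v)"
      using geometric_in_interval[of q "2 ^ (s + 1)" m] s m q by (metis gr_zeroI not_less_zero)
    then show ?thesis using that[of "e + (s + 1) * v" u]
      by (simp add: power_add power_mult mult_ac)
  qed
qed

section \<open>The bound\<close>

text \<open>Already \<open>2 * q ^ q \<le> 2 ^ (k ^ 4)\<close>, and the iterated logarithm is at least \<open>1 / 5\<close> for \<open>k \<ge> 4\<close>.\<close>

lemma two_mult_self_power_le_bound:
  fixes k q :: nat
  assumes "k > 3" "q \<le> k + 1"
  shows "real (2 * q ^ q) \<le> 2 powr (real k powr (10 ^ 10 * ln (ln (real k))))"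
proof -
  have "q ^ q \<le> (2 ^ q) ^ q" by (rule power_mono) (simp_all add: less_exp less_imp_le)
  then have "2 * q ^ q \<le> 2 ^ (q * q + 1)" by (simp add: power_mult)
  also have "\<dots> \<le> 2 ^ (k ^ 4)"
  proof (rule power_increasing)
    have "q * q + 1 \<le> (k + 1) * (k + 1) + 1" using assms by (intro add_le_mono mult_le_mono) auto
    also have "\<dots> = k * k + 2 * k + 2" by (simp add: algebra_simps)
    also have "\<dots> \<le> 16 * (k * k)"
    proof -
      have "k * 1 \<le> k * k" "1 \<le> k * k" using assms by (auto intro: mult_le_mono2)
      then show ?thesis by linarith
    qed
    also have "\<dots> \<le> (k * k) * (k * k)"
      by (intro mult_le_mono1) (use assms mult_le_mono[of 4 k 4 k] in simp)
    finally show "q * q + 1 \<le> k ^ 4" by (simp add: power4_eq_xxxx mult.assoc)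
  qed simp
  finally have "real (2 * q ^ q) \<le> 2 ^ (k ^ 4)"
    by (metis of_nat_le_iff of_nat_numeral of_nat_power)
  also have "\<dots> = 2 powr (real k powr 4)"
  proof -
    have "real k powr 4 = real (k ^ 4)" by simp
    then show ?thesis by (simp only:) (rule powr_realpow[symmetric], simp)
  qed
  also have "\<dots> \<le> 2 powr (real k powr (10 ^ 10 * ln (ln (real k))))"
  proof -
    have ln_ge: "1 - 1 / x \<le> ln x" if "x > 0" for x :: real
      using ln_le_minus_one[of "1 / x"] that by (simp add: ln_div)
    have "(5 / 4 :: real) \<le> ln 3 + ln (4 / 3)"
      using ln_ge[of "4 / 3"] exp_le ln_ge_iff[of 3 1] by simp
    also have "\<dots> = ln 4" using ln_mult[of 3 "4 / 3 :: real"] by simp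
    also have "\<dots> \<le> ln (real k)" using assms by (subst ln_le_cancel_iff) auto
    finally have l: "5 / 4 \<le> ln (real k)" .
    have "1 / 5 \<le> ln (5 / 4 :: real)" using ln_ge[of "5 / 4"] by simp
    also have "\<dots> \<le> ln (ln (real k))" using l by (subst ln_le_cancel_iff) auto
    finally have "4 \<le> 10 ^ 10 * ln (ln (real k))" by simp
    then show ?thesis using assms by (intro powr_mono) auto
  qed
  finally show ?thesis .
qed

lemma discriminator_le:
  assumes "pairwise_incong k M M" "n \<le> M" "M \<ge> 1"
  shows "discriminator k n \<le> M"
  unfolding discriminator_def
  by (rule Least_le) (use assms in \<open>auto simp: pairwise_incong_def\<close>)

lemma discriminator_discriminates:
  assumes "k > 3"
  shows "discriminator k n \<ge> 1" "pairwise_incong k n (discriminator k n)"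
proof -
  \<comment> \<open>Any large power of 2 separates the first \<open>n\<close> terms, so the least modulus exists.\<close>
  obtain q where q: "regular_prime k q" "odd q" using exists_odd_regular_prime[OF assms] by metis
  define M :: nat where "M = 2 ^ Suc n * q ^ 0"
  have "pairwise_incong k M M" unfolding M_def
    by (rule two_mult_prime_power_discriminates[OF q]) simp
  moreover have "n \<le> M" unfolding M_def using less_exp[of "Suc n"] by simp
  moreover have "M \<ge> 1" unfolding M_def by simp
  ultimately have "M \<ge> 1 \<and> pairwise_incong k n M" by (auto simp: pairwise_incong_def)
  then show "discriminator k n \<ge> 1" "pairwise_incong k n (discriminator k n)"
    unfolding discriminator_def by (metis (mono_tags, lifting) LeastI)+
qed

theorem theorem4:
  fixes k :: nat
  assumes "k > 3"
  shows "\<forall>m \<in> F_set k. real m \<le> 2 powr (real k powr (10 ^ 10 * ln (ln (real k))))"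
proof
  fix m assume "m \<in> F_set k"
  then obtain n where m: "m = discriminator k n" "m \<notin> A_set k \<union> B_set k"
    unfolding F_set_def D_set_def by auto
  obtain q where q: "regular_prime k q" "odd q" "q \<le> k + 1"
    using exists_odd_regular_prime[OF assms] .
  have m0: "m > 0" and inc: "pairwise_incong k n m"
    using discriminator_discriminates[OF assms, of n] m(1) by auto
  obtain i j where ij: "i < j" "3 * j \<le> 2 * m" "int m dvd U k j - U k i"
    using collision_outside[OF m0 m(2)] by blast
  have n: "n \<le> j"
  proof (rule ccontr)
    assume "\<not> n \<le> j"
    then show False
      using inc ij unfolding pairwise_incong_def cong_iff_dvd_diff
      by (metis less_trans nat_neq_iff not_le)
  qed
  have "m \<le> 2 * q ^ q"
  proof (rule ccontr)
    assume "\<not> m \<le> 2 * q ^ q"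
    moreover have "q > 1" using q(1) prime_gt_1_nat unfolding regular_prime_def by blast
    ultimately obtain e f where ef: "e \<ge> 1" "2 ^ e * q ^ f < m" "2 * m \<le> 3 * (2 ^ e * q ^ f)"
      using two_power_times_power_in_interval[OF q(2)] by (metis not_le)
    have "discriminator k n \<le> 2 ^ e * q ^ f"
    proof (rule discriminator_le)
      show "pairwise_incong k (2 ^ e * q ^ f) (2 ^ e * q ^ f)"
        using two_mult_prime_power_discriminates[OF q(1,2) ef(1)] .
      show "n \<le> 2 ^ e * q ^ f" using n ij(2) ef(3) by linarith
      show "1 \<le> 2 ^ e * q ^ f" using \<open>q > 1\<close> by simp
    qed
    with ef(2) m(1) show False by simp
  qed
  then have "real m \<le> real (2 * q ^ q)" by (simp only: of_nat_le_iff)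
  also have "\<dots> \<le> 2 powr (real k powr (10 ^ 10 * ln (ln (real k))))"
    by (rule two_mult_self_power_le_bound[OF assms q(3)])
  finally show "real m \<le> 2 powr (real k powr (10 ^ 10 * ln (ln (real k))))" .
qed

end
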